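(* Let $T$ be a doubly regular tournament with $n$ vertices. Then $$C(T)\leq \frac{1}{2}\binom{n}{2}+n^{\frac{3}{2}} \log_2 (2n).$$
   Context: A tournament is an oriented complete graph: a digraph $T$ on a finite vertex set $V(T)$ without loops such that for any two distinct vertices $x,y$ exactly one of the ordered pairs $(x,y)$, $(y,x)$ belongs to the edge set $E(T)$; $(x,y)$ denotes the edge directed from $x$ to $y$. A digraph is $d$-regular if the in-degree and the out-degree of each vertex equal $d$. For distinct vertices $x,y$, let $N^+(x,y)$ be the set of vertices $z$ with $(x,z),(y,z)\in E(T)$, and $N^-(x,y)$ the set of vertices $z$ with $(z,x),(z,y)\in E(T)$. A tournament $T$ with $n$ vertices is doubly regular if it is $(n-1)/2$-regular and for any two distinct vertices $x,y$ one has $|N^+(x,y)|=|N^-(x,y)|=(n-3)/4$. For a tournament $T$ with $n$ vertices and a bijection $\sigma:V(T)\to\{1,2,\ldots,n\}$, an edge $(x,y)$ of $T$ is consistent with $\sigma$ if $\sigma(x)<\sigma(y)$. $C(T,\sigma)$ is the number of edges of $T$ consistent with $\sigma$, and $C(T):=\max_{\sigma}C(T,\sigma)$, the maximum being over all such bijections. *)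

theory Defs
  imports Complex_Main "Graph_Theory.Pair_Digraph"
begin

locale tournament = pair_digraph T for T :: "'a pair_pre_digraph" +
  assumes exactly_one_arc:
    "\<lbrakk>x \<in> pverts T; y \<in> pverts T; x \<noteq> y\<rbrakk> \<Longrightarrow> (x, y) \<in> parcs T \<longleftrightarrow> (y, x) \<notin> parcs T"

(* The degree d is real so that "(n-1)/2-regular" and "(n-3)/4" below can be stated with
   exact division, instead of the truncating operations on nat. *)
definition regular_digraph :: "real \<Rightarrow> 'a pair_pre_digraph \<Rightarrow> bool" where
  "regular_digraph d T \<longleftrightarrow>
     (\<forall>v \<in> pverts T. real (in_degree (with_proj T) v) = d \<and> real (out_degree (with_proj T) v) = d)"

definition common_out :: "'a pair_pre_digraph \<Rightarrow> 'a \<Rightarrow> 'a \<Rightarrow> 'a set" where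
  "common_out T x y = {z \<in> pverts T. (x, z) \<in> parcs T \<and> (y, z) \<in> parcs T}"

definition common_in :: "'a pair_pre_digraph \<Rightarrow> 'a \<Rightarrow> 'a \<Rightarrow> 'a set" where
  "common_in T x y = {z \<in> pverts T. (z, x) \<in> parcs T \<and> (z, y) \<in> parcs T}"

locale doubly_regular_tournament = tournament T for T :: "'a pair_pre_digraph" +
  assumes regular: "regular_digraph ((real (card (pverts T)) - 1) / 2) T"
    and card_common_out: "\<lbrakk>x \<in> pverts T; y \<in> pverts T; x \<noteq> y\<rbrakk>
          \<Longrightarrow> real (card (common_out T x y)) = (real (card (pverts T)) - 3) / 4"
    and card_common_in: "\<lbrakk>x \<in> pverts T; y \<in> pverts T; x \<noteq> y\<rbrakk>
          \<Longrightarrow> real (card (common_in T x y)) = (real (card (pverts T)) - 3) / 4"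

definition vertex_orderings :: "'a pair_pre_digraph \<Rightarrow> ('a \<Rightarrow> nat) set" where
  "vertex_orderings T = {\<sigma>. bij_betw \<sigma> (pverts T) {1..card (pverts T)}}"

definition consistent_arcs :: "'a pair_pre_digraph \<Rightarrow> ('a \<Rightarrow> nat) \<Rightarrow> nat" where
  "consistent_arcs T \<sigma> = card {(x, y) \<in> parcs T. \<sigma> x < \<sigma> y}"

definition max_consistent_arcs :: "'a pair_pre_digraph \<Rightarrow> nat" where
  "max_consistent_arcs T = Max (consistent_arcs T ` vertex_orderings T)"

(* Max is meaningful here: the functions in vertex_orderings are arbitrary outside the vertex
   set, so there may be infinitely many of them, but the set of values is finite and nonempty. *)
lemma (in pair_fin_digraph) finite_consistent_arcs_image:
  "finite (consistent_arcs G ` vertex_orderings G)"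
proof (rule finite_subset)
  show "consistent_arcs G ` vertex_orderings G \<subseteq> {..card (parcs G)}"
    unfolding consistent_arcs_def using pair_finite_arcs by (auto intro!: card_mono)
qed simp

lemma (in pair_fin_digraph) vertex_orderings_nonempty: "vertex_orderings G \<noteq> {}"
  using finite_same_card_bij[OF pair_finite_verts, of "{1..card (pverts G)}"]
  by (auto simp: vertex_orderings_def)

end

theory Submission
  imports Defs "HOL-Analysis.Convex"
begin

text \<open>The skew matrix \<open>M\<close> with entries \<open>1\<close>, \<open>-1\<close> and \<open>0\<close> recording arcs, reversed arcs and the
  diagonal satisfies \<open>M M\<^sup>t = n I - J\<close>, so by Cauchy-Schwarz the entries of any block \<open>A \<times> B\<close> sum to
  at most \<open>(n |A| |B|)\<^sup>1\<^sup>/\<^sup>2\<close>. Twice the number of consistent arcs minus the number of all arcs is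
  the sum of \<open>M\<close> above the diagonal (in the order given by the ordering). Cutting the order in half
  recursively decomposes this triangle into at most \<open>log\<^sub>2 (2 n)\<close> levels of blocks, and each level
  contributes at most \<open>n\<^sup>3\<^sup>/\<^sup>2 / 2\<close>.\<close>

section \<open>Cutting an ordered set and bounding a triangular sum recursively\<close>

lemma exists_initial_segment:
  fixes \<sigma> :: "'a \<Rightarrow> 'b :: linorder"
  assumes "finite X" "inj_on \<sigma> X" "j \<le> card X"
  shows "\<exists>A \<subseteq> X. card A = j \<and> (\<forall>a\<in>A. \<forall>b\<in>X - A. \<sigma> a < \<sigma> b)"
  using assms(3)
proof (induction j)
  case 0
  then show ?case by (intro exI[of _ "{}"]) auto
next
  case (Suc j)
  then obtain A where A: "A \<subseteq> X" "card A = j" "\<And>a b. a \<in> A \<Longrightarrow> b \<in> X - A \<Longrightarrow> \<sigma> a < \<sigma> b"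
    by (metis Suc_leD)
  have fin: "finite (X - A)" "finite A"
    using assms(1) A(1) by (auto intro: finite_subset)
  have "X - A \<noteq> {}"
    using A(1,2) Suc.prems by auto
  \<comment> \<open>The segment grows by the \<open>\<sigma>\<close>-least element left over;
    injectivity of \<open>\<sigma>\<close> makes its minimality strict.\<close>
  then obtain m where m: "m \<in> X - A" "\<And>b. b \<in> X - A \<Longrightarrow> \<sigma> m \<le> \<sigma> b"
    using ex_min_if_finite[of "\<sigma> ` (X - A)"] fin by (force simp: not_less)
  have "\<sigma> a < \<sigma> b" if "a \<in> insert m A" "b \<in> X - insert m A" for a b
  proof (cases "a = m")
    case True
    have "\<sigma> b \<noteq> \<sigma> m"
      using inj_onD[OF assms(2), of b m] that(2) m(1) by auto
    then show ?thesis
      using m(2)[of b] that True by force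
  qed (use A(3) that in auto)
  moreover have "card (insert m A) = Suc j"
    using fin m(1) A(2) by simp
  ultimately show ?case
    using m(1) A(1) by (intro exI[of _ "insert m A"]) auto
qed

text \<open>For injective \<open>\<sigma>\<close> this is the sum above the diagonal once rows and
  columns are listed in the order of \<open>\<sigma>\<close>.\<close>

definition forward_sum :: "('a \<Rightarrow> 'a \<Rightarrow> real) \<Rightarrow> ('a \<Rightarrow> 'b :: linorder) \<Rightarrow> 'a set \<Rightarrow> real" where
  "forward_sum M \<sigma> X = (\<Sum>x\<in>X. \<Sum>y\<in>X. if \<sigma> x < \<sigma> y then M x y else 0)"

lemma forward_sum_Un:
  assumes "finite A" "finite B" "\<And>a b. a \<in> A \<Longrightarrow> b \<in> B \<Longrightarrow> \<sigma> a < \<sigma> b"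
  shows "forward_sum M \<sigma> (A \<union> B) =
           forward_sum M \<sigma> A + forward_sum M \<sigma> B + (\<Sum>a\<in>A. \<Sum>b\<in>B. M a b)"
proof -
  let ?f = "\<lambda>x y. if \<sigma> x < \<sigma> y then M x y else 0"
  have "A \<inter> B = {}"
    using assms(3) by fastforce
  then have "forward_sum M \<sigma> (A \<union> B) =
      (\<Sum>x\<in>A. \<Sum>y\<in>A. ?f x y) + (\<Sum>x\<in>A. \<Sum>y\<in>B. ?f x y) +
      ((\<Sum>x\<in>B. \<Sum>y\<in>A. ?f x y) + (\<Sum>x\<in>B. \<Sum>y\<in>B. ?f x y))"
    using assms(1,2) by (simp add: forward_sum_def sum.union_disjoint sum.distrib)
  moreover have "(\<Sum>x\<in>A. \<Sum>y\<in>B. ?f x y) = (\<Sum>a\<in>A. \<Sum>b\<in>B. M a b)"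
    using assms(3) by (intro sum.cong) auto
  moreover have "(\<Sum>x\<in>B. \<Sum>y\<in>A. ?f x y) = 0"
    using assms(3) by (force intro!: sum.neutral dest: less_asym)
  ultimately show ?thesis
    by (simp add: forward_sum_def)
qed

text \<open>Each of the \<open>k\<close> levels of cutting costs \<open>c * card X\<close> in total:
  the block between the two pieces of a set costs at most \<open>c\<close> times the size of that
  set, and the sets of one level are disjoint. A block bound additive in the two sizes makes this
  sum up without any balance between the pieces.\<close>

lemma forward_sum_le:
  fixes \<sigma> :: "'a \<Rightarrow> 'b :: linorder"
  assumes block: "\<And>A B. A \<subseteq> V \<Longrightarrow> B \<subseteq> V \<Longrightarrow>
      (\<Sum>a\<in>A. \<Sum>b\<in>B. M a b) \<le> c * (real (card A) + real (card B))"
    and "finite X" "X \<subseteq> V" "inj_on \<sigma> X" "card X \<le> 2 ^ k"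
  shows "forward_sum M \<sigma> X \<le> c * k * card X"
  using assms(2-)
proof (induction k arbitrary: X)
  case 0
  then have "X = {} \<or> (\<exists>x. X = {x})"
    by (metis One_nat_def card_1_singletonE card_eq_0_iff le_Suc_eq le_zero_eq power_0)
  then show ?case
    by (auto simp: forward_sum_def)
next
  case (Suc k)
  \<comment> \<open>This choice leaves at most \<open>2 ^ k\<close> elements on both sides; the
    second piece is empty if \<open>X\<close> is already that small.\<close>
  define j where "j = min (card X) (2 ^ k)"
  obtain A where A: "A \<subseteq> X" "card A = j" "\<And>a b. a \<in> A \<Longrightarrow> b \<in> X - A \<Longrightarrow> \<sigma> a < \<sigma> b"
    using exists_initial_segment[OF Suc.prems(1,3), of j] unfolding j_def by auto
  define B where "B = X - A"
  have X: "X = A \<union> B" "A \<inter> B = {}" and fin: "finite A" "finite B"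
    using A(1) Suc.prems(1) by (auto simp: B_def intro: finite_subset)
  have cX: "card X = card A + card B"
    using X fin by (simp add: card_Un_disjoint)
  have le: "card A \<le> 2 ^ k" "card B \<le> 2 ^ k"
    using cX A(2) Suc.prems(4) by (auto simp: j_def)
  have sub: "A \<subseteq> V" "B \<subseteq> V" "inj_on \<sigma> A" "inj_on \<sigma> B"
    using Suc.prems(2,3) X(1) by (auto intro: inj_on_subset)
  have "forward_sum M \<sigma> X =
      forward_sum M \<sigma> A + forward_sum M \<sigma> B + (\<Sum>a\<in>A. \<Sum>b\<in>B. M a b)"
    unfolding X(1) using fin A(3) by (intro forward_sum_Un) (auto simp: B_def)
  also have "\<dots> \<le> c * k * card A + c * k * card B + c * (real (card A) + real (card B))"
    using sub fin le by (intro add_mono Suc.IH block)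
  also have "\<dots> = c * Suc k * card X"
    by (simp add: cX algebra_simps)
  finally show ?case .
qed

section \<open>The skew matrix of a tournament\<close>

context tournament
begin

lemma no_loop: "(x, x) \<notin> parcs T"
  using pair_no_loops by fastforce

definition skew :: "'a \<Rightarrow> 'a \<Rightarrow> real" where
  "skew x y = of_bool ((x, y) \<in> parcs T) - of_bool ((y, x) \<in> parcs T)"

lemma skew_swap: "skew y x = - skew x y"
  by (simp add: skew_def)

text \<open>The product is 1 if \<open>z\<close> is a common out- or in-neighbour, -1 if
  \<open>z\<close> separates \<open>x\<close> from \<open>y\<close>, and 0 if \<open>z\<close> is
  one of them. This form sums over \<open>z\<close> to the cardinalities fixed by double
  regularity.\<close>

lemma skew_mult:
  assumes "x \<in> pverts T" "y \<in> pverts T" "z \<in> pverts T"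
  shows "skew x z * skew y z =
    2 * of_bool ((x, z) \<in> parcs T \<and> (y, z) \<in> parcs T) +
    2 * of_bool ((z, x) \<in> parcs T \<and> (z, y) \<in> parcs T) - of_bool (z \<noteq> x \<and> z \<noteq> y)"
  using exactly_one_arc[of x z] exactly_one_arc[of y z] assms no_loop
  by (auto simp: skew_def)

text \<open>A pair in increasing order contributes 1 if its arc is consistent and -1 otherwise, and
  the two kinds of arcs partition \<open>parcs T\<close>.\<close>

lemma forward_sum_skew:
  assumes "inj_on \<sigma> (pverts T)"
  shows "forward_sum skew \<sigma> (pverts T) = 2 * real (consistent_arcs T \<sigma>) - real (card (parcs T))"
proof -
  let ?V = "pverts T"
  let ?F = "{(x, y) \<in> parcs T. \<sigma> x < \<sigma> y}" and ?B = "{(x, y) \<in> parcs T. \<sigma> y < \<sigma> x}"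
  have count: "(\<Sum>x\<in>?V. \<Sum>y\<in>?V. of_bool ((x, y) \<in> S)) = real (card S)" if "S \<subseteq> parcs T" for S
  proof -
    have "S \<subseteq> ?V \<times> ?V"
      using that in_arcsD1 in_arcsD2 by auto
    then show ?thesis
      unfolding sum.cartesian_product by (simp add: case_prod_unfold Int_absorb1)
  qed
  have card: "card (parcs T) = card ?F + card ?B"
  proof -
    have "\<sigma> x \<noteq> \<sigma> y" if "(x, y) \<in> parcs T" for x y
      using that no_loop inj_onD[OF assms, of x y] in_arcsD1[OF that] in_arcsD2[OF that] by auto
    then have "parcs T = ?F \<union> ?B"
      by (auto simp: neq_iff)
    moreover have "?F \<inter> ?B = {}"
      by auto
    ultimately show ?thesis
      using pair_finite_arcs card_Un_disjoint[of ?F ?B]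
      by (simp add: finite_subset[of _ "parcs T"] subset_iff)
  qed
  have "forward_sum skew \<sigma> ?V =
      (\<Sum>x\<in>?V. \<Sum>y\<in>?V. of_bool ((x, y) \<in> ?F)) - (\<Sum>x\<in>?V. \<Sum>y\<in>?V. of_bool ((y, x) \<in> ?B))"
    unfolding forward_sum_def sum_subtractf[symmetric]
    by (intro sum.cong) (auto simp: skew_def)
  \<comment> \<open>Backward arcs occur with their ends exchanged; swapping the sums brings them to
    the shape of \<open>count\<close>.\<close>
  also have "(\<Sum>x\<in>?V. \<Sum>y\<in>?V. of_bool ((y, x) \<in> ?B)) =
      (\<Sum>y\<in>?V. \<Sum>x\<in>?V. of_bool ((y, x) \<in> ?B) :: real)"
    by (rule sum.swap)
  also have "(\<Sum>x\<in>?V. \<Sum>y\<in>?V. of_bool ((x, y) \<in> ?F)) - \<dots> = real (card ?F) - real (card ?B)"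
    by (subst (1 2) count) auto
  also have "\<dots> = 2 * real (consistent_arcs T \<sigma>) - real (card (parcs T))"
    using card by (simp add: consistent_arcs_def)
  finally show ?thesis .
qed

end

section \<open>Gram matrix, block sums and the bound for one ordering\<close>

context doubly_regular_tournament
begin

text \<open>On the diagonal there are \<open>n - 1\<close> squares equal to 1; off it,
  \<open>skew_mult\<close> gives \<open>4 * (n - 3) / 4 - (n - 2) = -1\<close>.\<close>

lemma skew_gram:
  assumes "x \<in> pverts T" "y \<in> pverts T"
  shows "(\<Sum>z\<in>pverts T. skew x z * skew y z) = (if x = y then real (card (pverts T)) else 0) - 1"
proof -
  let ?V = "pverts T" and ?n = "real (card (pverts T))"
  show ?thesis
  proof (cases "x = y")
    case True
    have "(\<Sum>z\<in>?V. skew x z * skew y z) = (\<Sum>z\<in>?V. of_bool (z \<noteq> x))"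
      using exactly_one_arc[of x] assms no_loop True
      by (intro sum.cong) (auto simp: skew_def)
    also have "\<dots> = real (card (?V - {x}))"
      by (simp add: set_diff_eq Int_def)
    also have "\<dots> = ?n - 1"
      using assms(1) card_Suc_Diff1[of ?V x] by simp
    finally show ?thesis
      using True by simp
  next
    case False
    have "(\<Sum>z\<in>?V. skew x z * skew y z) =
        2 * (\<Sum>z\<in>?V. of_bool ((x, z) \<in> parcs T \<and> (y, z) \<in> parcs T)) +
        2 * (\<Sum>z\<in>?V. of_bool ((z, x) \<in> parcs T \<and> (z, y) \<in> parcs T)) -
        (\<Sum>z\<in>?V. of_bool (z \<noteq> x \<and> z \<noteq> y))"
      using assms by (simp add: skew_mult sum.distrib sum_subtractf sum_distrib_left)
    also have "(\<Sum>z\<in>?V. of_bool ((x, z) \<in> parcs T \<and> (y, z) \<in> parcs T)) = real (card (common_out T x y))"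
      by (simp add: common_out_def Collect_conj_eq Int_assoc)
    also have "(\<Sum>z\<in>?V. of_bool ((z, x) \<in> parcs T \<and> (z, y) \<in> parcs T)) = real (card (common_in T x y))"
      by (simp add: common_in_def Collect_conj_eq Int_assoc)
    also have "(\<Sum>z\<in>?V. of_bool (z \<noteq> x \<and> z \<noteq> y)) = ?n - 2"
    proof -
      have "(\<Sum>z\<in>?V. of_bool (z \<noteq> x \<and> z \<noteq> y)) = real (card (?V - {x, y}))"
        by (simp add: Int_def set_diff_eq)
      also have "\<dots> = ?n - 2"
        using assms False card_mono[of ?V "{x, y}"] by (simp add: card_Diff_subset of_nat_diff)
      finally show ?thesis .
    qed
    finally show ?thesis
      using card_common_out[OF assms False] card_common_in[OF assms False] False
      by (simp add: field_simps)
  qed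
qed

text \<open>Cauchy-Schwarz over the rows in \<open>A\<close>, then the Gram matrix, bounds the
  squared sum by \<open>n\<close> times the product of the two sizes. AM-GM turns this into the
  additive bound that \<open>forward_sum_le\<close> requires.\<close>

lemma skew_block:
  assumes "A \<subseteq> pverts T" "B \<subseteq> pverts T"
  shows "(\<Sum>a\<in>A. \<Sum>b\<in>B. skew a b)
           \<le> sqrt (card (pverts T)) / 2 * (real (card A) + real (card B))"
proof -
  let ?V = "pverts T" and ?n = "real (card (pverts T))"
  let ?a = "real (card A)" and ?b = "real (card B)"
  have fin: "finite A" "finite B"
    using assms by (auto intro: finite_subset)
  have "(\<Sum>a\<in>A. \<Sum>b\<in>B. skew a b)\<^sup>2 \<le> (\<Sum>a\<in>A. (\<Sum>b\<in>B. skew a b)\<^sup>2) * ?a"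
    using sum_squared_le_sum_of_squares .
  \<comment> \<open>Only squares are added, and \<open>skew_gram\<close> needs the sum over all
    vertices.\<close>
  also have "(\<Sum>a\<in>A. (\<Sum>b\<in>B. skew a b)\<^sup>2) \<le> (\<Sum>a\<in>?V. (\<Sum>b\<in>B. skew a b)\<^sup>2)"
    using assms by (intro sum_mono2) auto
  \<comment> \<open>\<open>skew_gram\<close> is about rows, while columns are multiplied here;
    transposing changes two signs, which cancel.\<close>
  also have "\<dots> = (\<Sum>a\<in>?V. \<Sum>b\<in>B. \<Sum>b'\<in>B. skew b a * skew b' a)"
    unfolding power2_eq_square sum_product
    by (intro sum.cong refl) (metis skew_swap minus_mult_minus)
  also have "\<dots> = (\<Sum>b\<in>B. \<Sum>b'\<in>B. \<Sum>a\<in>?V. skew b a * skew b' a)"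
    by (simp only: sum.swap[where A = ?V and B = B])
  also have "\<dots> = (\<Sum>b\<in>B. \<Sum>b'\<in>B. (if b = b' then ?n else 0) - 1)"
    using assms(2) by (intro sum.cong skew_gram refl) auto
  also have "\<dots> = ?n * ?b - ?b\<^sup>2"
    using fin(2) by (simp add: sum_subtractf power2_eq_square algebra_simps)
  also have "\<dots> \<le> ?n * ?b"
    by simp
  finally have "(\<Sum>a\<in>A. \<Sum>b\<in>B. skew a b)\<^sup>2 \<le> ?n * (?a * ?b)"
    by (simp add: mult_right_mono mult_ac)
  also have "\<dots> \<le> ?n * ((?a + ?b) / 2)\<^sup>2"
    using zero_le_power2[of "?a - ?b"]
    by (intro mult_left_mono) (auto simp: power2_eq_square field_simps)
  also have "\<dots> = (sqrt ?n / 2 * (?a + ?b))\<^sup>2"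
    by (simp add: power_mult_distrib power_divide)
  finally show ?thesis
    by (rule power2_le_imp_le) simp
qed

text \<open>Counting arcs by their tails: every out-degree is \<open>(n - 1) / 2\<close>.\<close>

lemma card_parcs: "real (card (parcs T)) = real (card (pverts T) choose 2)"
proof -
  let ?V = "pverts T" and ?n = "real (card (pverts T))"
  have "parcs T = (\<Union>v\<in>?V. out_arcs T v)"
    using in_arcsD1 in_arcsD2 by (auto simp: out_arcs_def)
  moreover have "card (\<Union>v\<in>?V. out_arcs T v) = (\<Sum>v\<in>?V. out_degree T v)"
    unfolding out_degree_def by (intro card_UN_disjoint) (auto simp: out_arcs_def)
  ultimately have "real (card (parcs T)) = (\<Sum>v\<in>?V. real (out_degree T v))"
    by simp
  also have "\<dots> = (\<Sum>v\<in>?V. (?n - 1) / 2)"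
    using regular by (intro sum.cong) (auto simp: regular_digraph_def)
  also have "\<dots> = real (card ?V choose 2)"
    by (cases "card ?V") (simp_all add: choose_two real_of_nat_div algebra_simps)
  finally show ?thesis .
qed

text \<open>Here \<open>c\<close> is half of \<open>sqrt n\<close>; solving
  \<open>forward_sum_skew\<close> for the consistent arcs halves the error again, whence the
  4.\<close>

lemma consistent_arcs_le:
  assumes "\<sigma> \<in> vertex_orderings T" "card (pverts T) \<le> 2 ^ k"
  shows "consistent_arcs T \<sigma> \<le>
    1 / 2 * real (card (pverts T) choose 2) + sqrt (card (pverts T)) * card (pverts T) * k / 4"
proof -
  have inj: "inj_on \<sigma> (pverts T)"
    using assms(1) by (simp add: vertex_orderings_def bij_betw_def)
  have "forward_sum skew \<sigma> (pverts T) \<le>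
      sqrt (card (pverts T)) / 2 * k * card (pverts T)"
    using skew_block inj assms(2) by (intro forward_sum_le[where V = "pverts T"]) auto
  then show ?thesis
    using forward_sum_skew[OF inj] card_parcs by (simp add: field_simps)
qed

end

section \<open>The number of levels and the final estimate\<close>

lemma ex_power2_between:
  assumes "0 < n"
  shows "\<exists>k. n \<le> 2 ^ k \<and> real k \<le> log 2 (2 * real n)"
proof (intro exI conjI)
  \<comment> \<open>Rounding up adds less than 1 to \<open>log 2 n\<close>, which accounts for the 2
    in \<open>log 2 (2 * n)\<close>.\<close>
  let ?k = "nat \<lceil>log 2 (real n)\<rceil>"
  have "0 \<le> log 2 (real n)"
    using assms by simp
  then show "real ?k \<le> log 2 (2 * real n)"
    using assms by (simp add: log_mult) linarith
  have "real n = 2 powr log 2 (real n)"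
    using assms by simp
  also have "\<dots> \<le> 2 powr real ?k"
    by (intro powr_mono) linarith+
  also have "\<dots> = real (2 ^ ?k)"
    by (simp add: powr_realpow)
  finally show "n \<le> 2 ^ ?k"
    by linarith
qed

theorem theorem2p4:
  fixes T :: "'a pair_pre_digraph" and n :: nat
  assumes "doubly_regular_tournament T" and "card (pverts T) = n"
  shows "real (max_consistent_arcs T)
           \<le> 1 / 2 * real (n choose 2) + real n powr (3 / 2) * log 2 (2 * real n)"
proof -
  interpret doubly_regular_tournament T by fact
  have "max_consistent_arcs T \<in> consistent_arcs T ` vertex_orderings T"
    unfolding max_consistent_arcs_def
    using finite_consistent_arcs_image vertex_orderings_nonempty by (intro Max_in) auto
  then obtain \<sigma> where \<sigma>: "\<sigma> \<in> vertex_orderings T" "max_consistent_arcs T = consistent_arcs T \<sigma>"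
    by blast
  show ?thesis
  proof (cases "n = 0")
    \<comment> \<open>Without vertices zero levels suffice, and the right-hand side is 0 because
      \<open>0 powr (3 / 2) = 0\<close>.\<close>
    case True
    then show ?thesis
      using consistent_arcs_le[OF \<sigma>(1), of 0] \<sigma>(2) assms(2) by simp
  next
    case False
    then obtain k where k: "n \<le> 2 ^ k" "real k \<le> log 2 (2 * real n)"
      using ex_power2_between[of n] by auto
    have "real n powr (3 / 2) = real n powr (1 / 2 + 1)"
      by simp
    also have "\<dots> = sqrt n * n"
      using False by (simp only: powr_add powr_half_sqrt) simp
    finally have n: "real n powr (3 / 2) = sqrt n * n" .
    \<comment> \<open>The factor 1/4 gained above is given away.\<close>
    have "sqrt n * n * k / 4 \<le> sqrt n * n * k"
      by simp
    also have "\<dots> \<le> sqrt n * n * log 2 (2 * real n)"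
      using k(2) by (intro mult_left_mono) auto
    finally show ?thesis
      using consistent_arcs_le[OF \<sigma>(1), of k] k(1) \<sigma>(2) assms(2) n by simp
  qed
qed

end
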